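(* Let $l,T>0$, $\bar Q_T=\{(x,t):0\le x\le l,\ 0\le t\le T\}$, and let $\alpha:(0,l)\to(0,1)$ be continuous. Suppose $k\in C^{1,0}(\bar Q_T)$, $q,f\in C(\bar Q_T)$, $k(x,t)\ge c_1>0$ and $q(x,t)\ge 0$ everywhere on $\bar Q_T$. Let $u\in C^{2,1}(\bar Q_T)$ be a solution of the problem $$\partial_{0t}^{\alpha(x)}u=\frac{\partial}{\partial x}\left(k(x,t)\frac{\partial u}{\partial x}\right)-q(x,t)u+f(x,t),\quad 0<x<l,\ 0<t\le T,$$ $$u(0,t)=0,\quad u(l,t)=0,\quad 0\le t\le T,\qquad u(x,0)=u_0(x),\quad 0\le x\le l.$$ Then for all $t\in[0,T]$ the following a priori estimate holds: $$\int_0^l D_{0t}^{\alpha(x)-1}u^2(x,t)\,dx+c_1\int_0^t\|u_x(x,s)\|_0^2\,ds\le\frac{l^2}{2c_1}\int_0^t\|f(x,s)\|_0^2\,ds+\int_0^l\frac{t^{1-\alpha(x)}}{\Gamma(2-\alpha(x))}u_0^2(x)\,dx .$$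
   Context: $C^{m,n}(\bar Q_T)$ is the class of functions continuous on $\bar Q_T$ together with their partial derivatives of order $m$ with respect to $x$ and of order $n$ with respect to $t$. The Caputo derivative of (variable) order $\alpha(x)\in(0,1)$ is $\partial_{0t}^{\alpha(x)}u(x,t)=\frac{1}{\Gamma(1-\alpha(x))}\int_0^t u_\tau(x,\tau)(t-\tau)^{-\alpha(x)}\,d\tau$. For $\beta>0$, the Riemann--Liouville fractional integral of order $\beta$ is $D_{0t}^{-\beta}u(x,t)=\frac1{\Gamma(\beta)}\int_0^t(t-s)^{\beta-1}u(x,s)\,ds$; thus $D_{0t}^{\alpha(x)-1}$ is the fractional integral of order $1-\alpha(x)$, applied in $t$ for each fixed $x$. For a function $v(x,t)$, $\|v(x,t)\|_0^2=\int_0^l v^2(x,t)\,dx$ (a function of $t$). *)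

theory Defs
  imports "HOL-Analysis.Analysis"
begin

definition Qbar :: "real \<Rightarrow> real \<Rightarrow> (real \<times> real) set" where
  "Qbar l T = {0..l} \<times> {0..T}"

text \<open>Partial derivatives are taken relative to the closed rectangle, so that they are one-sided
  on its boundary; the values of a function outside the rectangle play no role.\<close>

definition partial_x :: "real \<Rightarrow> (real \<Rightarrow> real \<Rightarrow> real) \<Rightarrow> real \<Rightarrow> real \<Rightarrow> real" where
  "partial_x l v x t = vector_derivative (\<lambda>y. v y t) (at x within {0..l})"

definition partial_t :: "real \<Rightarrow> (real \<Rightarrow> real \<Rightarrow> real) \<Rightarrow> real \<Rightarrow> real \<Rightarrow> real" where
  "partial_t T v x t = vector_derivative (\<lambda>s. v x s) (at t within {0..T})"

text \<open>The class \<open>C\<^sup>m\<^sup>,\<^sup>n\<close> of the closed rectangle. All pure derivatives of order up to \<open>m\<close> in \<open>x\<close> and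
  up to \<open>n\<close> in \<open>t\<close> exist and are continuous; mixed derivatives are not involved. Existence is
  required explicitly because \<^const>\<open>vector_derivative\<close> is total.\<close>

definition C_class :: "real \<Rightarrow> real \<Rightarrow> nat \<Rightarrow> nat \<Rightarrow> (real \<Rightarrow> real \<Rightarrow> real) set" where
  "C_class l T m n = {v.
     (\<forall>i<m. \<forall>(x, t)\<in>Qbar l T.
        (\<lambda>y. (partial_x l ^^ i) v y t) differentiable (at x within {0..l})) \<and>
     (\<forall>j<n. \<forall>(x, t)\<in>Qbar l T.
        (\<lambda>s. (partial_t T ^^ j) v x s) differentiable (at t within {0..T})) \<and>
     (\<forall>i\<le>m. continuous_on (Qbar l T) (\<lambda>(x, t). (partial_x l ^^ i) v x t)) \<and>
     (\<forall>j\<le>n. continuous_on (Qbar l T) (\<lambda>(x, t). (partial_t T ^^ j) v x t))}"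

text \<open>In the two fractional operators the integrand at the endpoint \<open>s = t\<close> is \<open>0\<close> by the convention
  \<open>0 powr a = 0\<close>; this single point does not affect the integrals.\<close>

definition caputo ::
  "real \<Rightarrow> (real \<Rightarrow> real) \<Rightarrow> (real \<Rightarrow> real \<Rightarrow> real) \<Rightarrow> real \<Rightarrow> real \<Rightarrow> real" where
  "caputo T \<alpha> u x t =
     1 / Gamma (1 - \<alpha> x) * integral {0..t} (\<lambda>s. partial_t T u x s * (t - s) powr (- \<alpha> x))"

definition RL_integral :: "real \<Rightarrow> (real \<Rightarrow> real \<Rightarrow> real) \<Rightarrow> real \<Rightarrow> real \<Rightarrow> real" where
  "RL_integral \<beta> v x t =
     1 / Gamma \<beta> * integral {0..t} (\<lambda>s. (t - s) powr (\<beta> - 1) * v x s)"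

definition norm0_sq :: "real \<Rightarrow> (real \<Rightarrow> real \<Rightarrow> real) \<Rightarrow> real \<Rightarrow> real" where
  "norm0_sq l v t = integral {0..l} (\<lambda>x. (v x t)\<^sup>2)"

end

theory Submission
  imports Defs
begin

text \<open>Multiply the equation by \<open>u\<close> and integrate over \<open>{0..l} \<times> {0..t}\<close>. In space, integration by
  parts, the Young inequality and the Poincare inequality with constant \<open>l\<^sup>2 / 2\<close> absorb the
  source term into half of the dissipation. In time, for each fixed \<open>x\<close>, Alikhanov's inequality
  \<open>2 w \<partial>\<^sup>\<alpha> w \<ge> \<partial>\<^sup>\<alpha> (w\<^sup>2)\<close> holds, and the integral of \<open>\<partial>\<^sup>\<alpha> (w\<^sup>2)\<close> over \<open>{0..t}\<close> is the fractional
  integral of \<open>w\<^sup>2 - (w 0)\<^sup>2\<close> of order \<open>1 - \<alpha>\<close>. The two integrations are interchanged on \<open>u\<close> times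
  the right-hand side of the equation, which is continuous up to the boundary, so no uniformity
  of \<open>\<alpha>\<close> near the endpoints of \<open>{0<..<l}\<close> is required.\<close>

section \<open>The weakly singular kernel\<close>

lemma powr_kernel_antiderivative:
  fixes a s r :: real
  assumes "a < 1" "r < s"
  shows "((\<lambda>r. (s - r) powr (1 - a) / (1 - a)) has_vector_derivative - ((s - r) powr (- a))) (at r)"
proof -
  have "((\<lambda>r. (s - r) powr (1 - a)) has_real_derivative
      (1 - a) * (s - r) powr (1 - a - of_nat 1) * (0 - 1)) (at r)"
    using assms by (intro DERIV_fun_powr DERIV_diff DERIV_const DERIV_ident) auto
  from DERIV_cdivide[OF this, of "1 - a"] show ?thesis
    using assms by (simp add: has_real_derivative_iff_has_vector_derivative)
qed

lemma continuous_on_powr_kernel_antiderivative: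
  fixes a s :: real
  assumes "a < 1"
  shows "continuous_on {b..s} (\<lambda>r. (s - r) powr (1 - a) / (1 - a))"
  using assms by (auto intro!: continuous_intros continuous_on_powr')

text \<open>The antiderivative stays continuous at the singular endpoint \<open>r = s\<close>
  because \<open>1 - a > 0\<close>, so the fundamental theorem with differentiability only on the
  open interval applies.\<close>

lemma powr_kernel_has_integral:
  fixes a b s :: real
  assumes "b \<le> s" "a < 1"
  shows "((\<lambda>r. (s - r) powr (- a)) has_integral (s - b) powr (1 - a) / (1 - a)) {b..s}"
proof -
  have "((\<lambda>r. (s - r) powr (- a)) has_integral
     - ((s - s) powr (1 - a) / (1 - a)) - - ((s - b) powr (1 - a) / (1 - a))) {b..s}"
  proof (rule fundamental_theorem_of_calculus_interior)
    show "continuous_on {b..s} (\<lambda>r. - ((s - r) powr (1 - a) / (1 - a)))"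
      by (intro continuous_on_minus continuous_on_powr_kernel_antiderivative assms)
    show "((\<lambda>r. - ((s - r) powr (1 - a) / (1 - a))) has_vector_derivative (s - r) powr - a) (at r)"
      if "r \<in> {b<..<s}" for r
      using has_vector_derivative_minus[OF powr_kernel_antiderivative[of a r s]] that assms by simp
  qed (use assms in auto)
  then show ?thesis by simp
qed

text \<open>Reflection of the line moves the singularity to the left endpoint. This is the inner
  integral that appears once the order of integration is interchanged.\<close>

lemma powr_kernel_has_integral':
  fixes a b s :: real
  assumes "b \<le> s" "a < 1"
  shows "((\<lambda>r. (r - b) powr (- a)) has_integral (s - b) powr (1 - a) / (1 - a)) {b..s}"
proof -
  have "((\<lambda>r. (- b - r) powr (- a)) has_integral (- b - - s) powr (1 - a) / (1 - a)) {- s..- b}"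
    by (rule powr_kernel_has_integral) (use assms in auto)
  then show ?thesis
    by (subst (asm) has_integral_reflect_real[symmetric]) simp
qed

text \<open>For a nonnegative function gauge integrability is already absolute integrability, and
  Borel measurability allows passing from the completed measure to \<open>lborel\<close>, over which
  the Fubini theorem is applied.\<close>

lemma set_integrable_lborel_nonneg:
  fixes f :: "real \<Rightarrow> real"
  assumes "f \<in> borel_measurable borel" "f integrable_on {a..b}" "\<And>x. x \<in> {a..b} \<Longrightarrow> 0 \<le> f x"
  shows "set_integrable lborel {a..b} f"
proof -
  have "f absolutely_integrable_on {a..b}"
    by (rule nonnegative_absolutely_integrable_1) (use assms in auto)
  then show ?thesis
    using assms(1) unfolding set_integrable_def by (subst (asm) integrable_completion) auto
qed

text \<open>A continuous factor is bounded on the compact interval, so a multiple of the kernel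
  dominates the product.\<close>

lemma powr_kernel_set_integrable:
  fixes a s :: real
  assumes "b \<le> s" "a < 1" "continuous_on {b..s} g"
  shows "set_integrable lborel {b..s} (\<lambda>r. g r * (s - r) powr (- a))"
proof -
  obtain B where B: "\<And>r. r \<in> {b..s} \<Longrightarrow> norm (g r) \<le> B"
    by (metis assms(3) compact_Icc compact_continuous_image bounded_iff compact_imp_bounded imageI)
  have "set_integrable lborel {b..s} (\<lambda>r. (s - r) powr (- a))"
    using powr_kernel_has_integral[OF assms(1,2)]
    by (intro set_integrable_lborel_nonneg) (auto simp: integrable_on_def)
  then have "integrable lborel (\<lambda>r. indicator {b..s} r *\<^sub>R (s - r) powr (- a))"
    unfolding set_integrable_def .
  then have i: "integrable lborel (\<lambda>r. B * (indicator {b..s} r *\<^sub>R (s - r) powr (- a)))"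
    by simp
  have [measurable]: "(\<lambda>r. indicator {b..s} r *\<^sub>R g r) \<in> borel_measurable borel"
    by (rule borel_measurable_continuous_on_indicator) (use assms in auto)
  have "integrable lborel (\<lambda>r. (indicator {b..s} r *\<^sub>R g r) * (s - r) powr (- a))"
  proof (rule Bochner_Integration.integrable_bound[OF i])
    show "(\<lambda>r. (indicator {b..s} r *\<^sub>R g r) * (s - r) powr (- a)) \<in> borel_measurable lborel"
      by measurable
  qed (use B in \<open>auto simp: abs_mult indicator_def intro!: mult_right_mono order_trans[OF _ abs_ge_self]\<close>)
  then show ?thesis
    unfolding set_integrable_def by (simp add: mult.assoc)
qed

lemma powr_kernel_integrable:
  fixes a s :: real
  assumes "b \<le> s" "a < 1" "continuous_on {b..s} g"
  shows "(\<lambda>r. g r * (s - r) powr (- a)) integrable_on {b..s}"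
  using set_borel_integral_eq_integral(1)[OF powr_kernel_set_integrable[OF assms]] .

text \<open>Since \<open>w s - w r = O(s - r)\<close>, the boundary term \<open>(w s - w r)\<^sup>2 (s - r)\<^sup>-\<^sup>a\<close> vanishes
  at \<open>r = s\<close>, which agrees with the junk value \<open>0 powr (- a) = 0\<close>.\<close>

lemma Alikhanov_inequality:
  fixes w w' :: "real \<Rightarrow> real"
  assumes s: "0 \<le> s" and a: "0 < a" "a < 1"
    and w: "\<And>r. r \<in> {0..s} \<Longrightarrow> (w has_vector_derivative w' r) (at r within {0..s})"
    and w': "continuous_on {0..s} w'"
  shows "integral {0..s} (\<lambda>r. w r * w' r * (s - r) powr (- a))
    \<le> w s * integral {0..s} (\<lambda>r. w' r * (s - r) powr (- a))"
proof -
  have cw: "continuous_on {0..s} w"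
    using w has_vector_derivative_continuous continuous_on_eq_continuous_within by blast
  obtain B where B: "\<And>r. r \<in> {0..s} \<Longrightarrow> norm (w' r) \<le> B"
    by (metis w' compact_Icc compact_continuous_image bounded_iff compact_imp_bounded imageI)
  have lip: "\<bar>w s - w r\<bar> \<le> B * (s - r)" if "r \<in> {0..s}" for r
  proof -
    have "norm (w s - w r) \<le> B * norm (s - r)"
      by (rule differentiable_bound[of "{0..s}" w "\<lambda>x h. h * w' x"])
        (use w that s B in \<open>auto simp: has_vector_derivative_def abs_mult mult.commute[of B]
           intro!: onorm_le mult_left_mono\<close>)
    then show ?thesis using that by simp
  qed
  \<comment> \<open>\<open>P\<close> is the boundary term when
    \<open>(w s - w r) * w' r * (s - r) powr (- a)\<close> is integrated by parts. Its derivative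
    \<open>P'\<close> is this product minus a nonnegative term, so the difference of the two sides
    of the claim is at least \<open>P s - P 0\<close>, where
    \<open>P 0 \<le> 0 = P s\<close>.\<close>
  define P where "P r = - (w s - w r)\<^sup>2 / 2 * (s - r) powr (- a)" for r
  define P' where "P' r = (w s - w r) * w' r * (s - r) powr (- a)
      - (w s - w r)\<^sup>2 / 2 * (a * (s - r) powr (- a - 1))" for r
  have P: "(P' has_integral P s - P 0) {0..s}"
  proof (rule fundamental_theorem_of_calculus_interior)
    show "(P has_vector_derivative P' r) (at r)" if r: "r \<in> {0<..<s}" for r
    proof -
      have "(w has_vector_derivative w' r) (at r within {0<..<s})"
        using w[of r] r by (auto intro: has_vector_derivative_within_subset)
      then have w_r: "(w has_real_derivative w' r) (at r)"
        using r at_within_open[of r "{0<..<s}"]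
        by (simp add: has_real_derivative_iff_has_vector_derivative)
      have "((\<lambda>r. - (w s - w r)\<^sup>2 / 2) has_real_derivative (w s - w r) * w' r) (at r)"
        using w_r by (auto intro!: derivative_eq_intros)
      moreover have "((\<lambda>r. (s - r) powr (- a)) has_real_derivative
          (- a) * (s - r) powr (- a - of_nat 1) * (0 - 1)) (at r)"
        using r by (intro DERIV_fun_powr DERIV_diff DERIV_const DERIV_ident) auto
      ultimately have "(P has_real_derivative (w s - w r) * w' r * (s - r) powr (- a)
          + (- a) * (s - r) powr (- a - of_nat 1) * (0 - 1) * (- (w s - w r)\<^sup>2 / 2)) (at r)"
        unfolding P_def by (rule DERIV_mult)
      then show ?thesis
        by (simp add: P'_def has_real_derivative_iff_has_vector_derivative mult_ac)
    qed
    show "continuous_on {0..s} P"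
      unfolding continuous_on_def
    proof
      fix r assume r: "r \<in> {0..s}"
      show "(P \<longlongrightarrow> P r) (at r within {0..s})"
      proof (cases "r = s")
        case False
        with r cw show ?thesis
          unfolding P_def continuous_on_def by (auto intro!: tendsto_intros)
      next
        case True
        have "continuous_on {0..s} (\<lambda>r. B\<^sup>2 * (s - r) powr (2 - a))"
          using a by (intro continuous_intros continuous_on_powr') auto
        from bspec[OF this[unfolded continuous_on_def], of s]
        have z: "((\<lambda>r. B\<^sup>2 * (s - r) powr (2 - a)) \<longlongrightarrow> 0) (at s within {0..s})"
          using s by simp
        have "norm (P r) \<le> B\<^sup>2 * (s - r) powr (2 - a)" if "r \<in> {0..s}" for r
        proof (cases "r = s")
          case False
          have "(w s - w r)\<^sup>2 \<le> (B * (s - r))\<^sup>2"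
            using lip[OF that] by (intro power2_le_iff_abs_le[THEN iffD2]) auto
          then have "(w s - w r)\<^sup>2 / 2 * (s - r) powr (- a) \<le> (B * (s - r))\<^sup>2 * (s - r) powr (- a)"
            using zero_le_power2[of "w s - w r"] by (intro mult_right_mono powr_ge_zero) linarith
          also have "\<dots> = B\<^sup>2 * ((s - r) powr 2 * (s - r) powr (- a))"
            using that False by (simp add: power_mult_distrib)
          also have "\<dots> = B\<^sup>2 * (s - r) powr (2 - a)"
            by (simp add: powr_add[symmetric])
          finally show ?thesis by (simp add: P_def abs_mult)
        qed (simp add: P_def)
        then have "\<forall>\<^sub>F r in at s within {0..s}. norm (P r) \<le> B\<^sup>2 * (s - r) powr (2 - a)"
          by (simp add: eventually_at_filter)
        then have "(P \<longlongrightarrow> 0) (at s within {0..s})"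
          by (rule Lim_null_comparison) (rule z)
        then show ?thesis using True by (simp add: P_def)
      qed
    qed
  qed (use s in auto)
  have i1: "(\<lambda>r. w s * (w' r * (s - r) powr (- a))) integrable_on {0..s}"
    by (rule integrable_on_mult_right[OF powr_kernel_integrable[OF s a(2) w']])
  have i2: "(\<lambda>r. w r * w' r * (s - r) powr (- a)) integrable_on {0..s}"
    using powr_kernel_integrable[OF s a(2), of "\<lambda>r. w r * w' r"] cw w'
    by (auto intro!: continuous_intros)
  have "0 \<le> P s - P 0" by (simp add: P_def)
  also have "\<dots> \<le> integral {0..s} (\<lambda>r. w s * (w' r * (s - r) powr (- a)) - w r * w' r * (s - r) powr (- a))"
    by (rule has_integral_le[OF P integrable_integral[OF integrable_diff[OF i1 i2]]])
      (use a in \<open>auto simp: P'_def algebra_simps\<close>)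
  also have "\<dots> = w s * integral {0..s} (\<lambda>r. w' r * (s - r) powr (- a))
      - integral {0..s} (\<lambda>r. w r * w' r * (s - r) powr (- a))"
    by (subst Henstock_Kurzweil_Integration.integral_diff[OF i1 i2]) simp
  finally show ?thesis by simp
qed

text \<open>Fubini on the triangle \<open>0 \<le> r \<le> s \<le> t\<close>: for fixed
  \<open>r\<close> the kernel integrates over \<open>s\<close> in \<open>{r..t}\<close> to
  \<open>(t - r) powr (1 - a) / (1 - a)\<close>.\<close>

lemma integral_powr_kernel_swap:
  fixes g :: "real \<Rightarrow> real"
  assumes a: "a < 1" and g: "continuous_on {0..t} g"
  shows "((\<lambda>s. integral {0..s} (\<lambda>r. g r * (s - r) powr (- a))) has_integral
    integral {0..t} (\<lambda>r. g r * ((t - r) powr (1 - a) / (1 - a)))) {0..t}"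
proof -
  \<comment> \<open>Continuity of \<open>g\<close> is known on \<open>{0..t}\<close> only. The
    cut-off by zero is Borel on the whole line and makes \<open>h\<close> below vanish off the
    triangle.\<close>
  define G where "G r = indicator {0..t} r *\<^sub>R g r" for r
  have [measurable]: "G \<in> borel_measurable borel"
    unfolding G_def by (rule borel_measurable_continuous_on_indicator) (use g in auto)
  define h where "h r s = (if r \<le> s \<and> s \<le> t then G r * (s - r) powr (- a) else 0)" for r s
  have [measurable]: "case_prod h \<in> borel_measurable (lborel \<Otimes>\<^sub>M lborel)"
    unfolding h_def by measurable
  define K where "K r = (t - r) powr (1 - a) / (1 - a)" for r
  have K: "set_integrable lborel {r..t} (\<lambda>s. (s - r) powr (- a))"
    "(LINT s:{r..t}|lborel. (s - r) powr (- a)) = K r" if "r \<le> t" for r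
  proof -
    show *: "set_integrable lborel {r..t} (\<lambda>s. (s - r) powr (- a))"
      using powr_kernel_has_integral'[OF that a]
      by (intro set_integrable_lborel_nonneg) (auto simp: integrable_on_def)
    show "(LINT s:{r..t}|lborel. (s - r) powr (- a)) = K r"
      unfolding set_borel_integral_eq_integral(2)[OF *] K_def
      by (rule integral_unique[OF powr_kernel_has_integral'[OF that a]])
  qed
  have h_r: "h r s = G r * (indicator {r..t} s *\<^sub>R (s - r) powr (- a))" for r s
    by (auto simp: h_def G_def)
  have h_r_int: "integrable lborel (h r)" for r
    using K(1)[of r] unfolding h_r[abs_def]
    by (cases "r \<le> t") (auto simp: set_integrable_def G_def)
  have h_r_integral: "(LINT s|lborel. h r s) = indicator {0..t} r *\<^sub>R (g r * K r)" for r
    using K(2)[of r] by (cases "r \<le> t") (auto simp: h_r set_lebesgue_integral_def G_def)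
  have h_r_norm: "(LINT s|lborel. norm (h r s)) = indicator {0..t} r *\<^sub>R (\<bar>g r\<bar> * K r)" for r
    using K(2)[of r]
    by (cases "r \<le> t") (auto simp: h_r set_lebesgue_integral_def G_def abs_mult)
  have cK: "continuous_on {0..t} K"
    unfolding K_def by (rule continuous_on_powr_kernel_antiderivative[OF a])
  \<comment> \<open>The integral of \<open>norm (h r s)\<close> over \<open>s\<close> is
    \<open>\<bar>g r\<bar> * K r\<close> on \<open>{0..t}\<close>, which is continuous there and
    hence integrable; this justifies the interchange.\<close>
  have h_int: "integrable (lborel \<Otimes>\<^sub>M lborel) (case_prod h)"
  proof (rule lborel_pair.Fubini_integrable)
    show "integrable lborel (\<lambda>r. LINT s|lborel. norm (case_prod h (r, s)))"
      unfolding prod.case h_r_norm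
      by (rule borel_integrable_compact) (use g cK in \<open>auto intro!: continuous_intros\<close>)
  qed (use h_r_int in auto)
  define \<Phi> where "\<Phi> s = integral {0..s} (\<lambda>r. g r * (s - r) powr (- a))" for s
  have h_s: "(LINT r|lborel. h r s) = indicator {0..t} s *\<^sub>R \<Phi> s" for s
  proof (cases "s \<in> {0..t}")
    case True
    have "set_integrable lborel {0..s} (\<lambda>r. g r * (s - r) powr (- a))"
      by (rule powr_kernel_set_integrable)
        (use True a in \<open>auto intro: continuous_on_subset[OF g]\<close>)
    then have "\<Phi> s = (LINT r:{0..s}|lborel. g r * (s - r) powr (- a))"
      by (simp add: \<Phi>_def set_borel_integral_eq_integral(2))
    also have "\<dots> = (LINT r|lborel. h r s)"
      unfolding set_lebesgue_integral_def
      by (rule Bochner_Integration.integral_cong) (use True in \<open>auto simp: h_def G_def indicator_def\<close>)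
    finally show ?thesis using True by simp
  next
    case False
    then have "h r s = 0" for r by (auto simp: h_def G_def)
    then show ?thesis using False by simp
  qed
  have int_\<Phi>: "set_integrable lborel {0..t} \<Phi>"
    using lborel_pair.integrable_snd[OF h_int] by (simp add: h_s set_integrable_def)
  have "integral {0..t} \<Phi> = (LINT s|lborel. LINT r|lborel. h r s)"
    by (simp add: h_s set_borel_integral_eq_integral(2)[OF int_\<Phi>, symmetric] set_lebesgue_integral_def)
  also have "\<dots> = (LINT r|lborel. LINT s|lborel. h r s)"
    by (rule lborel_pair.Fubini_integral[OF h_int])
  also have "\<dots> = (LINT r:{0..t}|lborel. g r * K r)"
    by (simp add: h_r_integral set_lebesgue_integral_def)
  also have "\<dots> = integral {0..t} (\<lambda>r. g r * K r)"
    using g cK unfolding set_integrable_def[symmetric]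
    by (intro set_borel_integral_eq_integral(2) borel_integrable_atLeastAtMost') 
      (auto intro!: continuous_intros)
  finally show ?thesis
    using integrable_integral[OF set_borel_integral_eq_integral(1)[OF int_\<Phi>]]
    unfolding \<Phi>_def K_def by simp
qed

text \<open>After the interchange \<open>v'\<close> is paired with \<open>K\<close>, and integration
  by parts moves the derivative off \<open>v\<close>; since \<open>K t = 0\<close>, only the
  boundary term at \<open>0\<close> survives. Divided by \<open>Gamma (1 - a)\<close>, the identity
  says that integrating the Caputo derivative of \<open>v\<close> in time gives the fractional
  integral of order \<open>1 - a\<close> of \<open>v - v 0\<close>.\<close>

lemma integral_powr_kernel_deriv:
  fixes v v' :: "real \<Rightarrow> real"
  assumes t: "0 \<le> t" and a: "a < 1"
    and v: "\<And>r. r \<in> {0..t} \<Longrightarrow> (v has_vector_derivative v' r) (at r within {0..t})"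
    and v': "continuous_on {0..t} v'"
  shows "((\<lambda>s. integral {0..s} (\<lambda>r. v' r * (s - r) powr (- a))) has_integral
    integral {0..t} (\<lambda>r. v r * (t - r) powr (- a)) - v 0 * (t powr (1 - a) / (1 - a))) {0..t}"
proof -
  define K where "K r = (t - r) powr (1 - a) / (1 - a)" for r
  have cv: "continuous_on {0..t} v"
    using v has_vector_derivative_continuous continuous_on_eq_continuous_within by blast
  have cK: "continuous_on {0..t} K"
    unfolding K_def by (rule continuous_on_powr_kernel_antiderivative[OF a])
  have "((\<lambda>r. v r * - ((t - r) powr (- a)) + v' r * K r) has_integral v t * K t - v 0 * K 0) {0..t}"
  proof (rule fundamental_theorem_of_calculus_interior)
    show "((\<lambda>r. v r * K r) has_vector_derivative v r * - ((t - r) powr (- a)) + v' r * K r) (at r)"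
      if r: "r \<in> {0<..<t}" for r
    proof (rule has_vector_derivative_mult)
      have "(v has_vector_derivative v' r) (at r within {0<..<t})"
        using v[of r] r by (auto intro: has_vector_derivative_within_subset)
      then show "(v has_vector_derivative v' r) (at r)"
        using r at_within_open[of r "{0<..<t}"] by simp
      show "(K has_vector_derivative - ((t - r) powr (- a))) (at r)"
        unfolding K_def by (rule powr_kernel_antiderivative) (use a r in auto)
    qed
  qed (use t cv cK in \<open>auto intro!: continuous_intros\<close>)
  from integral_unique[OF has_integral_add[OF this
      integrable_integral[OF powr_kernel_integrable[OF t a cv]]]]
  have "integral {0..t} (\<lambda>r. v' r * K r)
    = v t * K t - v 0 * K 0 + integral {0..t} (\<lambda>r. v r * (t - r) powr (- a))"
    by simp
  moreover have "K t = 0" "K 0 = t powr (1 - a) / (1 - a)"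
    by (simp_all add: K_def)
  ultimately have "integral {0..t} (\<lambda>r. v' r * K r)
    = integral {0..t} (\<lambda>r. v r * (t - r) powr (- a)) - v 0 * (t powr (1 - a) / (1 - a))"
    by simp
  then show ?thesis
    using integral_powr_kernel_swap[OF a v'] unfolding K_def by metis
qed

text \<open>Absorbs the factor \<open>1 / (1 - a)\<close> of the kernel antiderivative into the
  Gamma function.\<close>

lemma Gamma_two_minus:
  fixes a :: real
  assumes "a < 1"
  shows "Gamma (2 - a) = (1 - a) * Gamma (1 - a)"
  using Gamma_plus1[of "1 - a"] assms by (simp add: nonpos_Ints_def add.commute[of 1])

text \<open>Alikhanov's inequality is applied on each \<open>{0..s}\<close> and then integrated over
  \<open>s\<close>. \<open>G\<close> agrees with the Caputo derivative of \<open>w\<close> at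
  positive times; in the application it is the right-hand side of the equation, so that
  integrability of \<open>w s * G s\<close> follows from continuity.\<close>

lemma Caputo_energy_inequality:
  fixes w w' G :: "real \<Rightarrow> real"
  assumes t: "0 \<le> t" and a: "0 < a" "a < 1"
    and w: "\<And>r. r \<in> {0..t} \<Longrightarrow> (w has_vector_derivative w' r) (at r within {0..t})"
    and w': "continuous_on {0..t} w'"
    and G: "\<And>s. s \<in> {0<..t} \<Longrightarrow> G s = 1 / Gamma (1 - a) * integral {0..s} (\<lambda>r. w' r * (s - r) powr (- a))"
    and int: "(\<lambda>s. w s * G s) integrable_on {0..t}"
  shows "1 / Gamma (1 - a) * integral {0..t} (\<lambda>s. (t - s) powr (- a) * (w s)\<^sup>2)
      - t powr (1 - a) / Gamma (2 - a) * (w 0)\<^sup>2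
    \<le> 2 * integral {0..t} (\<lambda>s. w s * G s)"
proof -
  have cw: "continuous_on {0..t} w"
    using w has_vector_derivative_continuous continuous_on_eq_continuous_within by blast
  have gpos: "Gamma (1 - a) > 0" using a by (simp add: Gamma_real_pos)
  define V where "V = integral {0..t} (\<lambda>r. (w r)\<^sup>2 * (t - r) powr (- a)) - (w 0)\<^sup>2 * (t powr (1 - a) / (1 - a))"
  have V: "((\<lambda>s. integral {0..s} (\<lambda>r. 2 * (w r * w' r) * (s - r) powr (- a))) has_integral V) {0..t}"
    unfolding V_def
  proof (rule integral_powr_kernel_deriv[OF t a(2)])
    fix r assume "r \<in> {0..t}"
    from has_vector_derivative_mult[OF w[OF this] w[OF this]]
    show "((\<lambda>r. (w r)\<^sup>2) has_vector_derivative 2 * (w r * w' r)) (at r within {0..t})"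
      by (simp add: power2_eq_square mult.commute)
  qed (use cw w' in \<open>auto intro!: continuous_intros\<close>)
  have "((\<lambda>s. (2 * Gamma (1 - a)) * (w s * G s)) has_integral
      (2 * Gamma (1 - a)) * integral {0..t} (\<lambda>s. w s * G s)) {0..t}"
    by (intro has_integral_mult_right integrable_integral int)
  \<comment> \<open>Nothing is known about \<open>G 0\<close>. Its contribution at the single point
    \<open>s = 0\<close> is replaced by \<open>0\<close>, which matches the integral over
    \<open>{0..0}\<close> on the other side.\<close>
  then have W: "((\<lambda>s. if s = 0 then 0 else 2 * Gamma (1 - a) * (w s * G s)) has_integral
      (2 * Gamma (1 - a)) * integral {0..t} (\<lambda>s. w s * G s)) {0..t}"
    by (rule has_integral_spike_finite[of "{0}", rotated 2]) auto
  have "V \<le> 2 * Gamma (1 - a) * integral {0..t} (\<lambda>s. w s * G s)"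
  proof (rule has_integral_le[OF V W])
    fix s assume s: "s \<in> {0..t}"
    show "integral {0..s} (\<lambda>r. 2 * (w r * w' r) * (s - r) powr (- a))
        \<le> (if s = 0 then 0 else 2 * Gamma (1 - a) * (w s * G s))"
    proof (cases "s = 0")
      case False
      have "integral {0..s} (\<lambda>r. w r * w' r * (s - r) powr (- a))
        \<le> w s * integral {0..s} (\<lambda>r. w' r * (s - r) powr (- a))"
      proof (rule Alikhanov_inequality)
        show "(w has_vector_derivative w' r) (at r within {0..s})" if "r \<in> {0..s}" for r
          using that s by (intro has_vector_derivative_within_subset[OF w]) auto
        show "continuous_on {0..s} w'"
          using s by (intro continuous_on_subset[OF w']) auto
      qed (use s a in auto)
      moreover have "integral {0..s} (\<lambda>r. w' r * (s - r) powr (- a)) = Gamma (1 - a) * G s"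
        using G[of s] s False gpos by simp
      moreover have "integral {0..s} (\<lambda>r. 2 * (w r * w' r) * (s - r) powr (- a))
          = 2 * integral {0..s} (\<lambda>r. w r * w' r * (s - r) powr (- a))"
        by (subst integral_mult_right[symmetric]) (simp add: mult.assoc)
      ultimately show ?thesis using False by (simp add: mult_ac)
    qed simp
  qed
  then have "V / Gamma (1 - a) \<le> 2 * integral {0..t} (\<lambda>s. w s * G s)"
    using gpos by (simp add: field_simps)
  moreover have "V / Gamma (1 - a) = 1 / Gamma (1 - a) * integral {0..t} (\<lambda>s. (t - s) powr (- a) * (w s)\<^sup>2)
      - t powr (1 - a) / Gamma (2 - a) * (w 0)\<^sup>2"
    using a by (simp add: V_def Gamma_two_minus diff_divide_distrib mult.commute)
  ultimately show ?thesis by simp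
qed

section \<open>Energy inequality in space\<close>

text \<open>Since \<open>v 0 = 0\<close>, the Cauchy-Schwarz inequality gives
  \<open>(v x)\<^sup>2 \<le> x * D\<close>, with \<open>D\<close> the integral of
  \<open>(v' x)\<^sup>2\<close> over \<open>{0..l}\<close>. Integrating \<open>x\<close> over
  \<open>{0..l}\<close> produces the constant \<open>l\<^sup>2 / 2\<close>.\<close>

lemma Poincare_inequality_interval:
  fixes v v' :: "real \<Rightarrow> real"
  assumes v: "\<And>x. x \<in> {0..l} \<Longrightarrow> (v has_vector_derivative v' x) (at x within {0..l})"
    and v': "continuous_on {0..l} v'" and v0: "v 0 = 0" and l: "0 \<le> l"
  shows "integral {0..l} (\<lambda>x. (v x)\<^sup>2) \<le> l\<^sup>2 / 2 * integral {0..l} (\<lambda>x. (v' x)\<^sup>2)"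
proof -
  have cv: "continuous_on {0..l} v"
    using v has_vector_derivative_continuous continuous_on_eq_continuous_within by blast
  define D where "D = integral {0..l} (\<lambda>x. (v' x)\<^sup>2)"
  have iD: "(\<lambda>x. (v' x)\<^sup>2) integrable_on {0..l}"
    by (intro integrable_continuous_interval continuous_intros v')
  have pw: "(v x)\<^sup>2 \<le> x * D" if x: "x \<in> {0..l}" for x
  proof (cases "x = 0")
    case False
    with x have x0: "x > 0" by simp
    \<comment> \<open>\<open>m\<close> is the mean slope of \<open>v\<close> on
      \<open>{0..x}\<close>; the integral of \<open>(v' y - m)\<^sup>2\<close> being nonnegative is
      the required case of Cauchy-Schwarz.\<close>
    define m where "m = v x / x"
    have 1: "(v' has_integral v x - v 0) {0..x}"
      by (rule fundamental_theorem_of_calculus)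
        (use x in \<open>auto intro!: has_vector_derivative_within_subset[OF v]\<close>)
    have ix: "(\<lambda>x. (v' x)\<^sup>2) integrable_on {0..x}"
      by (rule integrable_on_subinterval[OF iD]) (use x in auto)
    have "((\<lambda>y. (v' y)\<^sup>2 - 2 * m * v' y + m\<^sup>2) has_integral
        integral {0..x} (\<lambda>x. (v' x)\<^sup>2) - 2 * m * (v x - v 0) + x * m\<^sup>2) {0..x}"
      using has_integral_const_real[of "m\<^sup>2" 0 x] x
      by (intro has_integral_add has_integral_diff has_integral_mult_right 1 integrable_integral[OF ix]) auto
    then have "0 \<le> integral {0..x} (\<lambda>x. (v' x)\<^sup>2) - 2 * m * (v x - v 0) + x * m\<^sup>2"
    proof (rule has_integral_nonneg)
      show "0 \<le> (v' y)\<^sup>2 - 2 * m * v' y + m\<^sup>2" for y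
        using zero_le_power2[of "v' y - m"] by (simp add: power2_eq_square algebra_simps)
    qed
    moreover have "m * v x = (v x)\<^sup>2 / x" "x * m\<^sup>2 = (v x)\<^sup>2 / x"
      using x0 by (auto simp: m_def power2_eq_square)
    moreover have "integral {0..x} (\<lambda>x. (v' x)\<^sup>2) \<le> D"
      unfolding D_def by (rule integral_subset_le[OF _ ix iD]) (use x in auto)
    ultimately have "(v x)\<^sup>2 / x \<le> D" using v0 by (simp add: mult.assoc)
    then show ?thesis using x0 by (simp add: field_simps)
  qed (simp add: v0)
  have id: "((\<lambda>x. x * D) has_integral l\<^sup>2 / 2 * D - 0\<^sup>2 / 2 * D) {0..l}"
    by (rule fundamental_theorem_of_calculus[OF l])
      (auto simp: has_real_derivative_iff_has_vector_derivative[symmetric] intro!: derivative_eq_intros)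
  have "integral {0..l} (\<lambda>x. (v x)\<^sup>2) \<le> integral {0..l} (\<lambda>x. x * D)"
    by (rule integral_le[OF _ _ pw]) (auto intro!: integrable_continuous_interval continuous_intros cv)
  then show ?thesis unfolding integral_unique[OF id] by (simp add: D_def)
qed

text \<open>Integration by parts makes the diffusion term contribute at most \<open>- c\<close>
  times the integral of \<open>(v' x)\<^sup>2\<close>, and the term with \<open>q\<close> has a
  favourable sign. Young and Poincare give back half of the dissipation, and the factor
  \<open>2\<close> restores the coefficient \<open>c\<close>.\<close>

lemma elliptic_energy_inequality:
  fixes v v' k p' q f :: "real \<Rightarrow> real"
  assumes l: "0 < l" and c: "0 < c"
    and v: "\<And>x. x \<in> {0..l} \<Longrightarrow> (v has_vector_derivative v' x) (at x within {0..l})"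
    and v': "continuous_on {0..l} v'" and v0: "v 0 = 0" and vl: "v l = 0"
    and p: "\<And>x. x \<in> {0..l} \<Longrightarrow> ((\<lambda>y. k y * v' y) has_vector_derivative p' x) (at x within {0..l})"
    and p': "continuous_on {0..l} p'"
    and q: "continuous_on {0..l} q" and f: "continuous_on {0..l} f"
    and kc: "\<And>x. x \<in> {0..l} \<Longrightarrow> c \<le> k x" and q0: "\<And>x. x \<in> {0..l} \<Longrightarrow> 0 \<le> q x"
  shows "2 * integral {0..l} (\<lambda>x. v x * (p' x - q x * v x + f x)) + c * integral {0..l} (\<lambda>x. (v' x)\<^sup>2)
    \<le> l\<^sup>2 / (2 * c) * integral {0..l} (\<lambda>x. (f x)\<^sup>2)"
proof -
  have cv: "continuous_on {0..l} v"
    using v has_vector_derivative_continuous continuous_on_eq_continuous_within by blast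
  note [continuous_intros] = cv v' p' q f
  \<comment> \<open>By the product rule \<open>?P\<close> is the derivative of
    \<open>v x * (k x * v' x)\<close>, so its integral is a boundary term, which vanishes because
    \<open>v 0 = v l = 0\<close>.\<close>
  let ?P = "\<lambda>x. v x * p' x + v' x * (k x * v' x)"
  have IP: "(?P has_integral v l * (k l * v' l) - v 0 * (k 0 * v' 0)) {0..l}"
    by (rule fundamental_theorem_of_calculus) (use l has_vector_derivative_mult[OF v p] in auto)
  have IX: "((\<lambda>x. X x) has_integral integral {0..l} X) {0..l}" if "continuous_on {0..l} X" for X :: "real \<Rightarrow> real"
    using that by (intro integrable_integral integrable_continuous_interval)
  let ?L = "integral {0..l} (\<lambda>x. v x * (p' x - q x * v x + f x))"
  let ?D = "integral {0..l} (\<lambda>x. (v' x)\<^sup>2)"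
  let ?V = "integral {0..l} (\<lambda>x. (v x)\<^sup>2)"
  let ?F = "integral {0..l} (\<lambda>x. (f x)\<^sup>2)"
  have 1: "((\<lambda>x. v x * (p' x - q x * v x + f x) + c * (v' x)\<^sup>2) has_integral ?L + c * ?D) {0..l}"
    by (intro has_integral_add has_integral_mult_right IX continuous_intros)
  have 2: "((\<lambda>x. ?P x + (c / l\<^sup>2 * (v x)\<^sup>2 + l\<^sup>2 / (4 * c) * (f x)\<^sup>2)) has_integral
      (v l * (k l * v' l) - v 0 * (k 0 * v' 0)) + (c / l\<^sup>2 * ?V + l\<^sup>2 / (4 * c) * ?F)) {0..l}"
    by (intro has_integral_add has_integral_mult_right IX IP continuous_intros)
  have 3: "?L + c * ?D \<le> (v l * (k l * v' l) - v 0 * (k 0 * v' 0)) + (c / l\<^sup>2 * ?V + l\<^sup>2 / (4 * c) * ?F)"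
  proof (rule has_integral_le[OF 1 2])
    fix x assume x: "x \<in> {0..l}"
    \<comment> \<open>By the Poincare inequality the weight \<open>c / l\<^sup>2\<close> costs exactly half of the dissipation term.\<close>
    have "0 \<le> (sqrt c / l * v x - l / (2 * sqrt c) * f x)\<^sup>2" by simp
    also have "\<dots> = c / l\<^sup>2 * (v x)\<^sup>2 + l\<^sup>2 / (4 * c) * (f x)\<^sup>2 - v x * f x"
      using l c by (simp add: power2_diff power_mult_distrib power_divide)
    finally have "v x * f x \<le> c / l\<^sup>2 * (v x)\<^sup>2 + l\<^sup>2 / (4 * c) * (f x)\<^sup>2" by simp
    moreover have "c * (v' x)\<^sup>2 \<le> v' x * (k x * v' x)"
      using mult_right_mono[OF kc[OF x], of "(v' x)\<^sup>2"] by (simp add: power2_eq_square mult_ac)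
    moreover have "0 \<le> q x * (v x * v x)" using q0[OF x] by simp
    ultimately show "v x * (p' x - q x * v x + f x) + c * (v' x)\<^sup>2
        \<le> ?P x + (c / l\<^sup>2 * (v x)\<^sup>2 + l\<^sup>2 / (4 * c) * (f x)\<^sup>2)"
      by (simp add: algebra_simps)
  qed
  have 4: "c / l\<^sup>2 * ?V \<le> c / l\<^sup>2 * (l\<^sup>2 / 2 * ?D)"
    by (intro mult_left_mono Poincare_inequality_interval v v' v0) (use l c in auto)
  have 5: "c / l\<^sup>2 * (l\<^sup>2 / 2 * ?D) = c * ?D / 2" using l by simp
  have 6: "v l * (k l * v' l) - v 0 * (k 0 * v' 0) = 0" using v0 vl by simp
  have 7: "l\<^sup>2 / (2 * c) * ?F = 2 * (l\<^sup>2 / (4 * c) * ?F)" by simp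
  have "2 * L + D \<le> 2 * A" if "L + D \<le> z + (y + A)" "y \<le> y'" "y' = D / 2" "z = 0"
    for L D z y y' A :: real
    using that by linarith
  from this[OF 3 4 5 6] show ?thesis unfolding 7 .
qed

section \<open>Measurability of the fractional integral in the order\<close>

text \<open>The order varies with \<open>x\<close>, so measurability comes from writing the inner
  integral as a Lebesgue integral of a jointly Borel function. A constant dominates the result even
  if \<open>\<alpha>\<close> tends to \<open>0\<close> or \<open>1\<close> at the ends.\<close>

lemma RL_integral_integrable:
  fixes w :: "real \<Rightarrow> real \<Rightarrow> real" and \<alpha> :: "real \<Rightarrow> real"
  assumes \<alpha>: "continuous_on {0<..<l} \<alpha>" "\<And>x. x \<in> {0<..<l} \<Longrightarrow> \<alpha> x \<in> {0<..<1}"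
    and t: "0 \<le> t" and w: "continuous_on ({0..l} \<times> {0..t}) (\<lambda>(x, s). w x s)"
  shows "(\<lambda>x. RL_integral (1 - \<alpha> x) w x t) integrable_on {0<..<l}"
proof -
  obtain B where B: "\<And>x s. x \<in> {0..l} \<Longrightarrow> s \<in> {0..t} \<Longrightarrow> \<bar>w x s\<bar> \<le> B"
  proof -
    have "bounded ((\<lambda>(x, s). w x s) ` ({0..l} \<times> {0..t}))"
      by (intro compact_imp_bounded compact_continuous_image w compact_Times compact_Icc)
    then show ?thesis using that unfolding bounded_iff by force
  qed
  \<comment> \<open>The value \<open>1 / 2\<close> extends \<open>\<alpha>\<close> to a Borel
    function on the line with all values strictly between \<open>0\<close> and
    \<open>1\<close>.\<close>
  define a where "a x = (if x \<in> {0<..<l} then \<alpha> x else 1 / 2)" for x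
  have [measurable]: "a \<in> borel_measurable borel"
    unfolding a_def by (rule borel_measurable_continuous_on_if) (use \<alpha> in auto)
  have a: "0 < a x" "a x < 1" for x using \<alpha>(2)[of x] by (auto simp: a_def)
  define W where "W y = indicator ({0..l} \<times> {0..t}) y *\<^sub>R (case y of (x, s) \<Rightarrow> w x s)" for y
  have "W \<in> borel_measurable borel"
    unfolding W_def by (rule borel_measurable_continuous_on_indicator[OF _ w])
      (intro borel_closed closed_Times closed_atLeastAtMost)
  then have [measurable]: "W \<in> borel_measurable (borel \<Otimes>\<^sub>M borel)"
    by (simp add: borel_prod)
  define J where "J x = (LINT s|lborel. W (x, s) * (t - s) powr (- a x))" for x
  have [measurable]: "J \<in> borel_measurable borel"
    unfolding J_def by measurable
  \<comment> \<open>\<open>Gamma\<close> is continuous on the positive axis, where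
    \<open>1 - a x\<close> always lies; the cut-off elsewhere gives a Borel function to compose
    with.\<close>
  have "(\<lambda>y::real. if y \<in> {0<..} then Gamma y else 0) \<in> borel_measurable borel"
    by (rule borel_measurable_continuous_on_if)
      (auto intro!: continuous_on_Gamma simp: nonpos_Ints_def)
  from measurable_compose[OF _ this, of "\<lambda>x. 1 - a x" borel]
  have [measurable]: "(\<lambda>x. Gamma (1 - a x)) \<in> borel_measurable borel"
    using a by simp
  have J: "J x = integral {0..t} (\<lambda>s. (t - s) powr (- a x) * w x s)"
    "\<bar>J x\<bar> \<le> B * (t powr (1 - a x) / (1 - a x))" if x: "x \<in> {0<..<l}" for x
  proof -
    have "continuous_on {0..t} (\<lambda>s. (\<lambda>(x, s). w x s) (x, s))"
      by (rule continuous_on_compose2[OF w]) (use x in \<open>auto intro!: continuous_intros\<close>)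
    then have cw: "continuous_on {0..t} (w x)" by simp
    note i = powr_kernel_set_integrable[OF t a(2) cw, of x]
    have "J x = (LINT s:{0..t}|lborel. w x s * (t - s) powr (- a x))"
      unfolding J_def set_lebesgue_integral_def
      by (rule Bochner_Integration.integral_cong) (use x in \<open>auto simp: W_def indicator_def\<close>)
    then have Jx: "J x = integral {0..t} (\<lambda>s. w x s * (t - s) powr (- a x))"
      by (simp add: set_borel_integral_eq_integral(2)[OF i])
    then show "J x = integral {0..t} (\<lambda>s. (t - s) powr (- a x) * w x s)"
      by (simp add: mult.commute)
    have "((\<lambda>s. B * (t - s) powr (- a x)) has_integral B * ((t - 0) powr (1 - a x) / (1 - a x))) {0..t}"
      by (intro has_integral_mult_right powr_kernel_has_integral t a)
    from has_integral_integrable[OF this] integral_unique[OF this]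
    have bd: "(\<lambda>s. B * (t - s) powr (- a x)) integrable_on {0..t}"
      "integral {0..t} (\<lambda>s. B * (t - s) powr (- a x)) = B * (t powr (1 - a x) / (1 - a x))"
      unfolding diff_0_right .
    have "norm (integral {0..t} (\<lambda>s. w x s * (t - s) powr (- a x)))
        \<le> integral {0..t} (\<lambda>s. B * (t - s) powr (- a x))"
      by (rule integral_norm_bound_integral[OF set_borel_integral_eq_integral(1)[OF i] bd(1)])
        (use B[of x] x in \<open>auto simp: abs_mult intro!: mult_right_mono\<close>)
    then show "\<bar>J x\<bar> \<le> B * (t powr (1 - a x) / (1 - a x))"
      using Jx bd(2) by simp
  qed
  \<comment> \<open>As \<open>2 - a x\<close> lies between \<open>1\<close> and \<open>2\<close>,
    the minimum \<open>Gamma z\<close> bounds \<open>Gamma (2 - a x)\<close> from below uniformly in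
    \<open>x\<close>. Combining \<open>(1 - a x) * Gamma (1 - a x)\<close> into this value removes
    the possibly unbounded factor \<open>1 / (1 - a x)\<close>.\<close>
  have "continuous_on {1..2::real} Gamma"
    by (intro continuous_on_Gamma) (auto simp: nonpos_Ints_def)
  from continuous_attains_inf[OF _ _ this]
  obtain z :: real where z: "z \<in> {1..2}" "\<And>y. y \<in> {1..2} \<Longrightarrow> Gamma z \<le> Gamma y"
    by auto
  have z0: "Gamma z > 0" using z by (intro Gamma_real_pos) auto
  have bound: "\<bar>1 / Gamma (1 - a x) * J x\<bar> \<le> B * max 1 t / Gamma z" if x: "x \<in> {0<..<l}" for x
  proof -
    have B0: "0 \<le> B" using B[of x 0] x t by auto
    have g: "Gamma (1 - a x) > 0" using a by (intro Gamma_real_pos) simp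
    \<comment> \<open>A base of at least \<open>1\<close> makes the power increasing in the
      exponent, so exponent \<open>1\<close> gives a bound free of \<open>x\<close>.\<close>
    have "t powr (1 - a x) \<le> max 1 t powr (1 - a x)"
      using a t by (intro powr_mono2) (auto simp: less_imp_le)
    also have "\<dots> \<le> max 1 t powr 1"
      using a by (intro powr_mono) (auto simp: less_imp_le)
    finally have tm: "t powr (1 - a x) \<le> max 1 t" by simp
    have "\<bar>1 / Gamma (1 - a x) * J x\<bar> = \<bar>J x\<bar> / Gamma (1 - a x)"
      using g by (simp add: abs_mult)
    also have "\<dots> \<le> B * (t powr (1 - a x) / (1 - a x)) / Gamma (1 - a x)"
      using J(2)[OF x] g by (intro divide_right_mono) auto
    also have "\<dots> = B * t powr (1 - a x) / Gamma (2 - a x)"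
      using a by (simp add: Gamma_two_minus)
    also have "\<dots> \<le> B * max 1 t / Gamma z"
      using a[of x] z(2)[of "2 - a x"] z0 tm B0
      by (intro frac_le mult_left_mono) (auto simp: less_imp_le)
    finally show ?thesis .
  qed
  have "set_integrable lborel {0<..<l} (\<lambda>x. B * max 1 t / Gamma z)"
    by (cases "0 \<le> l") (auto simp: set_integrable_def)
  then have "set_integrable lborel {0<..<l} (\<lambda>x. 1 / Gamma (1 - a x) * J x)"
    unfolding set_integrable_def
  proof (rule Bochner_Integration.integrable_bound)
    show "AE x in lborel. norm (indicat_real {0<..<l} x *\<^sub>R (1 / Gamma (1 - a x) * J x))
        \<le> norm (indicat_real {0<..<l} x *\<^sub>R (B * max 1 t / Gamma z))"
    proof (rule AE_I2)
      fix x
      show "norm (indicat_real {0<..<l} x *\<^sub>R (1 / Gamma (1 - a x) * J x))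
          \<le> norm (indicat_real {0<..<l} x *\<^sub>R (B * max 1 t / Gamma z))"
        using order_trans[OF bound[of x] abs_ge_self] by (cases "x \<in> {0<..<l}") simp_all
    qed
  qed measurable
  then have "(\<lambda>x. 1 / Gamma (1 - a x) * J x) integrable_on {0<..<l}"
    by (rule set_borel_integral_eq_integral(1))
  then show ?thesis
    by (rule integrable_eq) (simp add: J RL_integral_def, simp add: a_def)
qed

section \<open>The a priori estimate\<close>

lemma C_class_partial_x:
  assumes "v \<in> C_class l T m n" "i < m" "x \<in> {0..l}" "t \<in> {0..T}"
  shows "((\<lambda>y. (partial_x l ^^ i) v y t) has_vector_derivative (partial_x l ^^ Suc i) v x t)
    (at x within {0..l})"
  using assms unfolding C_class_def Qbar_def
  by (auto simp: partial_x_def[of l "(partial_x l ^^ i) v"] vector_derivative_works[symmetric])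

lemma C_class_partial_t:
  assumes "v \<in> C_class l T m n" "j < n" "x \<in> {0..l}" "t \<in> {0..T}"
  shows "((\<lambda>s. (partial_t T ^^ j) v x s) has_vector_derivative (partial_t T ^^ Suc j) v x t)
    (at t within {0..T})"
  using assms unfolding C_class_def Qbar_def
  by (auto simp: partial_t_def[of T "(partial_t T ^^ j) v"] vector_derivative_works[symmetric])

lemma C_class_continuous_x:
  assumes "v \<in> C_class l T m n" "i \<le> m"
  shows "continuous_on ({0..l} \<times> {0..T}) (\<lambda>z. (partial_x l ^^ i) v (fst z) (snd z))"
  using assms unfolding C_class_def Qbar_def by (auto simp: case_prod_beta)

lemma C_class_continuous_t:
  assumes "v \<in> C_class l T m n" "j \<le> n"
  shows "continuous_on ({0..l} \<times> {0..T}) (\<lambda>z. (partial_t T ^^ j) v (fst z) (snd z))"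
  using assms unfolding C_class_def Qbar_def by (auto simp: case_prod_beta)

lemma continuous_on_slices:
  assumes "continuous_on ({0..l} \<times> {0..T}) (\<lambda>z. g (fst z) (snd z))"
  shows "s \<in> {0..T} \<Longrightarrow> continuous_on {0..l} (\<lambda>x. g x s)"
    and "x \<in> {0..l} \<Longrightarrow> continuous_on {0..T} (g x)"
proof -
  show "continuous_on {0..l} (\<lambda>x. g x s)" if "s \<in> {0..T}"
  proof -
    have "continuous_on {0..l} (\<lambda>x. g (fst (x, s)) (snd (x, s)))"
      by (rule continuous_on_compose2[OF assms]) (use that in \<open>auto intro!: continuous_intros\<close>)
    then show ?thesis by simp
  qed
  show "continuous_on {0..T} (g x)" if "x \<in> {0..l}"
  proof -
    have "continuous_on {0..T} (\<lambda>s. g (fst (x, s)) (snd (x, s)))"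
      by (rule continuous_on_compose2[OF assms]) (use that in \<open>auto intro!: continuous_intros\<close>)
    then show ?thesis by simp
  qed
qed

lemma continuous_on_integral_fst:
  fixes g :: "real \<Rightarrow> real \<Rightarrow> real"
  assumes "continuous_on ({0..l} \<times> {0..T}) (\<lambda>z. g (fst z) (snd z))"
  shows "continuous_on {0..T} (\<lambda>s. integral {0..l} (\<lambda>x. g x s))"
proof -
  have "continuous_on ({0..T} \<times> cbox 0 l) (\<lambda>z. g (fst (prod.swap z)) (snd (prod.swap z)))"
    by (rule continuous_on_compose2[OF assms continuous_on_swap]) auto
  then have "continuous_on ({0..T} \<times> cbox 0 l) (\<lambda>(s, x). g x s)"
    by (simp add: case_prod_beta)
  from integral_continuous_on_param[OF this] show ?thesis by simp
qed

lemma continuous_on_norm0_sq: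
  assumes "continuous_on ({0..l} \<times> {0..T}) (\<lambda>z. g (fst z) (snd z))"
  shows "continuous_on {0..T} (norm0_sq l g)"
  unfolding norm0_sq_def[abs_def]
  by (rule continuous_on_integral_fst) (intro continuous_intros assms)

theorem theorem1:
  fixes l T c1 :: real
    and \<alpha> u0 :: "real \<Rightarrow> real"
    and k q f u :: "real \<Rightarrow> real \<Rightarrow> real"
  assumes "l > 0" and "T > 0"
    and "continuous_on {0<..<l} \<alpha>"
    and "\<And>x. x \<in> {0<..<l} \<Longrightarrow> \<alpha> x \<in> {0<..<1}"
    and "k \<in> C_class l T 1 0"
    and "q \<in> C_class l T 0 0"
    and "f \<in> C_class l T 0 0"
    and "c1 > 0"
    and "\<And>x t. (x, t) \<in> Qbar l T \<Longrightarrow> k x t \<ge> c1"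
    and "\<And>x t. (x, t) \<in> Qbar l T \<Longrightarrow> q x t \<ge> 0"
    and "u \<in> C_class l T 2 1"
    and "\<And>x t. 0 < x \<Longrightarrow> x < l \<Longrightarrow> 0 < t \<Longrightarrow> t \<le> T \<Longrightarrow>
           caputo T \<alpha> u x t =
             partial_x l (\<lambda>y s. k y s * partial_x l u y s) x t - q x t * u x t + f x t"
    and "\<And>t. 0 \<le> t \<Longrightarrow> t \<le> T \<Longrightarrow> u 0 t = 0"
    and "\<And>t. 0 \<le> t \<Longrightarrow> t \<le> T \<Longrightarrow> u l t = 0"
    and "\<And>x. 0 \<le> x \<Longrightarrow> x \<le> l \<Longrightarrow> u x 0 = u0 x"
  shows "\<forall>t\<in>{0..T}.
    integral {0<..<l} (\<lambda>x. RL_integral (1 - \<alpha> x) (\<lambda>y s. (u y s)\<^sup>2) x t)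
      + c1 * integral {0..t} (\<lambda>s. norm0_sq l (partial_x l u) s)
    \<le> l\<^sup>2 / (2 * c1) * integral {0..t} (\<lambda>s. norm0_sq l f s)
      + integral {0<..<l} (\<lambda>x. t powr (1 - \<alpha> x) / Gamma (2 - \<alpha> x) * (u0 x)\<^sup>2)"
proof
  fix t assume t: "t \<in> {0..T}"
  note l = \<open>l > 0\<close> and c = \<open>c1 > 0\<close> and k = assms(5) and q = assms(6) and f = assms(7)
    and u = assms(11) and \<alpha> = assms(3,4)

  \<comment> \<open>The flux and the right-hand side of the equation\<close>
  define p where "p x s = k x s * partial_x l u x s" for x s
  define p' where "p' x s = partial_x l k x s * partial_x l u x s
    + k x s * partial_x l (partial_x l u) x s" for x s
  \<comment> \<open>\<open>G\<close> is the right-hand side with the flux derivative expanded. It is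
    continuous on the whole closed rectangle, while it is identified with the Caputo derivative only
    for \<open>x\<close> in \<open>{0<..<l}\<close> and \<open>s > 0\<close>.\<close>
  define G where "G x s = p' x s - q x s * u x s + f x s" for x s
  let ?R = "{0..l} \<times> {0..T}"
  have ux: "((\<lambda>y. u y s) has_vector_derivative partial_x l u x s) (at x within {0..l})"
    and uxx: "((\<lambda>y. partial_x l u y s) has_vector_derivative partial_x l (partial_x l u) x s) (at x within {0..l})"
    and kx: "((\<lambda>y. k y s) has_vector_derivative partial_x l k x s) (at x within {0..l})"
    and ut: "(u x has_vector_derivative partial_t T u x s) (at s within {0..T})"
    if "x \<in> {0..l}" "s \<in> {0..T}" for x s
    using C_class_partial_x[OF u, of 0] C_class_partial_x[OF u, of 1] C_class_partial_x[OF k, of 0]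
      C_class_partial_t[OF u, of 0] that by auto
  have px: "((\<lambda>y. p y s) has_vector_derivative p' x s) (at x within {0..l})"
    if "x \<in> {0..l}" "s \<in> {0..T}" for x s
    using has_vector_derivative_mult[OF kx[OF that] uxx[OF that]] by (simp add: p_def p'_def add.commute)
  have cu: "continuous_on ?R (\<lambda>z. u (fst z) (snd z))"
    and cux: "continuous_on ?R (\<lambda>z. partial_x l u (fst z) (snd z))"
    and cuxx: "continuous_on ?R (\<lambda>z. partial_x l (partial_x l u) (fst z) (snd z))"
    and cut: "continuous_on ?R (\<lambda>z. partial_t T u (fst z) (snd z))"
    and ck: "continuous_on ?R (\<lambda>z. k (fst z) (snd z))"
    and ckx: "continuous_on ?R (\<lambda>z. partial_x l k (fst z) (snd z))"
    and cq: "continuous_on ?R (\<lambda>z. q (fst z) (snd z))"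
    and cf: "continuous_on ?R (\<lambda>z. f (fst z) (snd z))"
    using C_class_continuous_x[OF u, of 0] C_class_continuous_x[OF u, of 1] C_class_continuous_x[OF u, of 2]
      C_class_continuous_t[OF u, of 1] C_class_continuous_x[OF k, of 0] C_class_continuous_x[OF k, of 1]
      C_class_continuous_x[OF q, of 0] C_class_continuous_x[OF f, of 0]
    by (simp_all add: numeral_2_eq_2)
  have cp': "continuous_on ?R (\<lambda>z. p' (fst z) (snd z))"
    unfolding p'_def by (intro continuous_intros ckx cux ck cuxx)
  have cG: "continuous_on ?R (\<lambda>z. G (fst z) (snd z))"
    unfolding G_def by (intro continuous_intros cp' cq cu cf)
  have cuG: "continuous_on ?R (\<lambda>z. u (fst z) (snd z) * G (fst z) (snd z))"
    by (intro continuous_intros cu cG)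
  have pde: "G x s = 1 / Gamma (1 - \<alpha> x) * integral {0..s} (\<lambda>r. partial_t T u x r * (s - r) powr (- \<alpha> x))"
    if "x \<in> {0<..<l}" "s \<in> {0<..T}" for x s
  proof -
    \<comment> \<open>Derivatives within a nondegenerate closed interval are unique, so the product
      rule determines the total function \<open>partial_x\<close> here.\<close>
    have "partial_x l p x s = p' x s"
      unfolding partial_x_def
      by (rule vector_derivative_within_closed_interval) (use l that px in auto)
    then show ?thesis
      using assms(12)[of x s] that unfolding caputo_def G_def p_def[abs_def] by simp
  qed

  \<comment> \<open>Energy estimate in space, integrated in time\<close>
  have energy: "2 * integral {0..l} (\<lambda>x. u x s * G x s) + c1 * norm0_sq l (partial_x l u) s
      \<le> l\<^sup>2 / (2 * c1) * norm0_sq l f s" if s: "s \<in> {0..T}" for s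
    unfolding norm0_sq_def G_def
    by (rule elliptic_energy_inequality[OF l c, where k = "\<lambda>x. k x s"])
      (use s l ux px assms(9,10,13,14) continuous_on_slices(1)[OF cux s] continuous_on_slices(1)[OF cp' s]
        continuous_on_slices(1)[OF cq s] continuous_on_slices(1)[OF cf s]
        in \<open>auto simp: p_def Qbar_def\<close>)
  have sub: "{0..l} \<times> {0..t} \<subseteq> ?R" "{0..t} \<subseteq> {0..T}" using t by auto
  have cuG_t: "continuous_on (cbox (0, 0) (l, t)) (\<lambda>(x, s). u x s * G x s)"
    using continuous_on_subset[OF cuG sub(1)] by (simp add: case_prod_beta cbox_Pair_eq)
  have cs: "continuous_on {0..t} (\<lambda>s. integral {0..l} (\<lambda>x. u x s * G x s))"
    by (rule continuous_on_subset[OF continuous_on_integral_fst sub(2)]) (rule cuG)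
  have in1: "norm0_sq l (partial_x l u) integrable_on {0..t}" "norm0_sq l f integrable_on {0..t}"
    by (intro integrable_continuous_interval continuous_on_subset[OF continuous_on_norm0_sq sub(2)] cux cf)+
  have time: "2 * integral {0..t} (\<lambda>s. integral {0..l} (\<lambda>x. u x s * G x s))
      + c1 * integral {0..t} (norm0_sq l (partial_x l u)) \<le> l\<^sup>2 / (2 * c1) * integral {0..t} (norm0_sq l f)"
  proof (rule has_integral_le)
    show "((\<lambda>s. 2 * integral {0..l} (\<lambda>x. u x s * G x s) + c1 * norm0_sq l (partial_x l u) s)
      has_integral 2 * integral {0..t} (\<lambda>s. integral {0..l} (\<lambda>x. u x s * G x s))
      + c1 * integral {0..t} (norm0_sq l (partial_x l u))) {0..t}"
      by (intro has_integral_add has_integral_mult_right integrable_integral in1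
          integrable_continuous_interval cs)
    show "((\<lambda>s. l\<^sup>2 / (2 * c1) * norm0_sq l f s) has_integral
      l\<^sup>2 / (2 * c1) * integral {0..t} (norm0_sq l f)) {0..t}"
      by (intro has_integral_mult_right integrable_integral in1)
  qed (use energy sub in auto)
  \<comment> \<open>Dropping the endpoints of \<open>{0..l}\<close> changes no integral and leaves
    only points where the order \<open>\<alpha> x\<close> is controlled.\<close>
  have swap: "integral {0..t} (\<lambda>s. integral {0..l} (\<lambda>x. u x s * G x s))
      = integral {0<..<l} (\<lambda>x. integral {0..t} (\<lambda>s. u x s * G x s))"
    using integral_swap_continuous[OF cuG_t] by (simp add: integral_open_interval_real)

  \<comment> \<open>Fractional terms, integrated in space\<close>
  let ?A = "\<lambda>x. RL_integral (1 - \<alpha> x) (\<lambda>y s. (u y s)\<^sup>2) x t"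
  let ?B = "\<lambda>x. t powr (1 - \<alpha> x) / Gamma (2 - \<alpha> x) * (u0 x)\<^sup>2"
  have iA: "?A integrable_on {0<..<l}"
    by (rule RL_integral_integrable)
      (use \<alpha> t continuous_on_subset[OF cu sub(1)] in \<open>auto simp: case_prod_beta intro!: continuous_intros\<close>)
  have cu0: "continuous_on {0..l} (\<lambda>x. u x 0)"
    by (rule continuous_on_slices(1)[OF cu]) (use t in auto)
  \<comment> \<open>The initial term \<open>?B\<close> is the fractional integral of
    \<open>(u x 0)\<^sup>2\<close> taken as constant in time, so its integrability is another case
    of the same lemma.\<close>
  have "(\<lambda>x. RL_integral (1 - \<alpha> x) (\<lambda>y s. (u y 0)\<^sup>2) x t) integrable_on {0<..<l}"
    by (rule RL_integral_integrable)
      (use \<alpha> t in \<open>auto simp: case_prod_beta intro!: continuous_intros continuous_on_compose2[OF cu0]\<close>)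
  then have iB: "?B integrable_on {0<..<l}"
  proof (rule integrable_eq)
    fix x assume x: "x \<in> {0<..<l}"
    have "((\<lambda>s. (t - s) powr (- \<alpha> x) * (u x 0)\<^sup>2) has_integral
      (t - 0) powr (1 - \<alpha> x) / (1 - \<alpha> x) * (u x 0)\<^sup>2) {0..t}"
      by (intro has_integral_mult_left powr_kernel_has_integral) (use t \<alpha>(2)[OF x] in auto)
    from integral_unique[OF this] show "RL_integral (1 - \<alpha> x) (\<lambda>y s. (u y 0)\<^sup>2) x t = ?B x"
      using \<alpha>(2)[OF x] x assms(15)[of x] by (simp add: RL_integral_def Gamma_two_minus)
  qed
  have icu: "(\<lambda>x. integral {0..t} (\<lambda>s. u x s * G x s)) integrable_on {0<..<l}"
    using integral_integrable_2dim[OF cuG_t] by (simp add: integrable_on_open_interval_real)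
  have "integral {0<..<l} (\<lambda>x. ?A x - ?B x)
      \<le> integral {0<..<l} (\<lambda>x. 2 * integral {0..t} (\<lambda>s. u x s * G x s))"
  proof (rule integral_le[OF integrable_diff[OF iA iB] integrable_on_mult_right[OF icu]])
    fix x assume x: "x \<in> {0<..<l}"
    then have xl: "x \<in> {0..l}" by simp
    have "1 / Gamma (1 - \<alpha> x) * integral {0..t} (\<lambda>s. (t - s) powr (- \<alpha> x) * (u x s)\<^sup>2)
        - t powr (1 - \<alpha> x) / Gamma (2 - \<alpha> x) * (u x 0)\<^sup>2
      \<le> 2 * integral {0..t} (\<lambda>s. u x s * G x s)"
    proof (rule Caputo_energy_inequality)
      show "(u x has_vector_derivative partial_t T u x r) (at r within {0..t})" if "r \<in> {0..t}" for r
        using that sub xl by (intro has_vector_derivative_within_subset[OF ut]) auto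
      show "continuous_on {0..t} (partial_t T u x)"
        by (rule continuous_on_subset[OF continuous_on_slices(2)[OF cut xl] sub(2)])
      show "(\<lambda>s. u x s * G x s) integrable_on {0..t}"
        by (intro integrable_continuous_interval continuous_on_subset[OF _ sub(2)]
            continuous_on_mult continuous_on_slices(2)[OF cu xl] continuous_on_slices(2)[OF cG xl])
    qed (use t x \<alpha>(2)[OF x] pde in auto)
    then show "?A x - ?B x \<le> 2 * integral {0..t} (\<lambda>s. u x s * G x s)"
      using assms(15)[of x] x by (simp add: RL_integral_def)
  qed
  then have "integral {0<..<l} ?A - integral {0<..<l} ?B
      \<le> 2 * integral {0<..<l} (\<lambda>x. integral {0..t} (\<lambda>s. u x s * G x s))"
    unfolding Henstock_Kurzweil_Integration.integral_diff[OF iA iB] integral_mult_right .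
  \<comment> \<open>Twice the double integral of \<open>u x s * G x s\<close> links the two halves:
    the fractional terms bound it from below, the source minus the dissipation from above.\<close>
  with time swap show "integral {0<..<l} ?A + c1 * integral {0..t} (\<lambda>s. norm0_sq l (partial_x l u) s)
    \<le> l\<^sup>2 / (2 * c1) * integral {0..t} (\<lambda>s. norm0_sq l f s) + integral {0<..<l} ?B"
    by linarith
qed

end
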